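(* Let $M, D, B > 0$ and $P$ be real scalars, and consider the single-machine infinite-bus system $$M\ddot{\theta} = -D\dot{\theta} + P - B\theta + w,\qquad y = B^{\frac12}\theta ,$$ with scalar disturbance input $w$ and scalar output $y$. Let $G$ be the transfer function from $w$ to $y$. Then $$\|G\|_2 = \left(\frac{1}{2D}\right)^{\frac12}$$ and $$\|G\|_\infty = \begin{cases} \dfrac{2M\sqrt{B}}{D\sqrt{4MB-D^2}}, & \text{if } \dfrac{D^2}{2MB}\le 1,\\[2mm] \dfrac{1}{\sqrt{B}}, & \text{otherwise.}\end{cases}$$
   Context: The constant $P$ only shifts the equilibrium; the transfer function from $w$ to $y$ is taken about the equilibrium, i.e. $G(s)=C(sI-A)^{-1}F$ with state $(\theta,\dot\theta)$ (shifted), $A=\begin{bmatrix}0&1\\-B/M&-D/M\end{bmatrix}$, $F=\begin{bmatrix}0\\1/M\end{bmatrix}$, $C=\begin{bmatrix}B^{1/2}&0\end{bmatrix}$. The system norms are $$\|G\|_2=\left(\frac{1}{2\pi}\operatorname{trace}\int_{-\infty}^{\infty}G^*(j\omega)G(j\omega)\,d\omega\right)^{\frac12},\qquad \|G\|_\infty=\sup_{\omega\in\mathbb{R}}\lambda_{\max}^{\frac12}\big(G^*(j\omega)G(j\omega)\big),$$ where $j=\sqrt{-1}$ and $G^*(j\omega)$ is the conjugate transpose of $G(j\omega)$. *)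

theory Defs
  imports "HOL-Analysis.Analysis"
begin

(* Affine state-space systems  x' = A x + F w + b,  y = C x.
   The constant drift b moves the equilibrium and does not enter the transfer function,
   which relates the deviations from the equilibrium (cf. trajectory_shift). *)
record ('n::finite, 'm::finite, 'p::finite) affine_system =
  state_mat :: "real ^ 'n ^ 'n"
  input_mat :: "real ^ 'm ^ 'n"
  output_mat :: "real ^ 'n ^ 'p"
  drift :: "real ^ 'n"

definition trajectory ::
  "('n::finite, 'm::finite, 'p::finite) affine_system \<Rightarrow>
    (real \<Rightarrow> real ^ 'n) \<Rightarrow> (real \<Rightarrow> real ^ 'm) \<Rightarrow> (real \<Rightarrow> real ^ 'p) \<Rightarrow> bool" where
  "trajectory S x w y \<longleftrightarrow>
    (\<forall>t. (x has_vector_derivative (state_mat S *v x t + input_mat S *v w t + drift S)) (at t)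
       \<and> y t = output_mat S *v x t)"

(* mat s is s times the identity. *)
definition transfer_function ::
  "('n::finite, 'm::finite, 'p::finite) affine_system \<Rightarrow> complex \<Rightarrow> complex ^ 'm ^ 'p" where
  "transfer_function S s =
    map_matrix complex_of_real (output_mat S)
      ** matrix_inv (mat s - map_matrix complex_of_real (state_mat S))
      ** map_matrix complex_of_real (input_mat S)"

definition conj_transpose :: "complex ^ 'm ^ 'p \<Rightarrow> complex ^ 'p ^ 'm" where
  "conj_transpose H = map_matrix cnj (transpose H)"

definition eigenvalue :: "complex ^ 'm ^ 'm \<Rightarrow> complex \<Rightarrow> bool" where
  "eigenvalue H l \<longleftrightarrow> (\<exists>v. v \<noteq> 0 \<and> H *v v = l *s v)"

(* Meant for Hermitian matrices, all of whose eigenvalues are real. *)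
definition lambda_max :: "complex ^ 'm ^ 'm \<Rightarrow> real" where
  "lambda_max H = Max {r. eigenvalue H (complex_of_real r)}"

(* G*(j omega) G(j omega) *)
definition gram_at :: "(complex \<Rightarrow> complex ^ 'm ^ 'p) \<Rightarrow> real \<Rightarrow> complex ^ 'm ^ 'm" where
  "gram_at G \<omega> =
    conj_transpose (G (\<i> * complex_of_real \<omega>)) ** G (\<i> * complex_of_real \<omega>)"

(* Both norms are extended-real valued, so that an equation with a real right-hand side
   includes convergence of the integral and boundedness of the supremum. *)
definition h2_norm :: "(complex \<Rightarrow> complex ^ 'm ^ 'p) \<Rightarrow> ereal" where
  "h2_norm G =
    (if integrable lborel (gram_at G)
     then ereal (sqrt (1 / (2 * pi) * Re (trace (LINT \<omega>|lborel. gram_at G \<omega>))))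
     else \<infinity>)"

definition hinf_norm :: "(complex \<Rightarrow> complex ^ 'm ^ 'p) \<Rightarrow> ereal" where
  "hinf_norm G = (SUP \<omega>. ereal (sqrt (lambda_max (gram_at G \<omega>))))"

(* The single-machine infinite-bus system, with state (theta, theta'). *)
definition smib :: "real \<Rightarrow> real \<Rightarrow> real \<Rightarrow> real \<Rightarrow> (2, 1, 1) affine_system" where
  "smib M D B P =
    \<lparr> state_mat = vector [vector [0, 1], vector [- B / M, - D / M]],
      input_mat = vector [vector [0], vector [1 / M]],
      output_mat = vector [vector [sqrt B, 0]],
      drift = vector [0, P / M] \<rparr>"

lemma trajectory_smib:
  assumes "M > 0"
  shows "trajectory (smib M D B P) (\<lambda>t. vector [\<theta> t, v t]) (\<lambda>t. vector [w t]) (\<lambda>t. vector [y t])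
    \<longleftrightarrow> (\<forall>t. (\<theta> has_real_derivative v t) (at t) \<and>
             (\<exists>a. (v has_real_derivative a) (at t) \<and> M * a = - D * v t + P - B * \<theta> t + w t) \<and>
             y t = sqrt B * \<theta> t)"
proof -
  have vec2: "((\<lambda>t. vector [\<theta> t, v t] :: real ^ 2) has_vector_derivative d) (at t) \<longleftrightarrow>
      (\<theta> has_real_derivative d $ 1) (at t) \<and> (v has_real_derivative d $ 2) (at t)" for d t
    unfolding has_vector_derivative_def has_field_derivative_def
    by (subst has_derivative_componentwise_within)
       (auto simp: Basis_vec_def inner_axis forall_2 UNIV_2 mult_commute_abs)
  have ode: "(\<exists>a. (v has_real_derivative a) (at t) \<and> M * a = r) \<longleftrightarrow>
      (v has_real_derivative r / M) (at t)" for t r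
    using assms by (auto simp: field_simps)
  have rhs: "- B / M * a + - D / M * b + c / M + P / M = (- D * b + P - B * a + c) / M" for a b c
    by (simp add: divide_simps)
  show ?thesis
    unfolding trajectory_def vec2 ode
    using rhs by (simp add: smib_def matrix_vector_mult_def sum_2 vec_eq_iff forall_2)
qed

lemma trajectory_shift:
  assumes "state_mat S *v x0 + drift S = 0"
  shows "trajectory S x w y \<longleftrightarrow>
    trajectory (S\<lparr>drift := 0\<rparr>) (\<lambda>t. x t - x0) w (\<lambda>t. y t - output_mat S *v x0)"
proof -
  have eq: "state_mat S *v x t + input_mat S *v w t + drift S =
      state_mat S *v (x t - x0) + input_mat S *v w t" for t
    using assms by (simp add: matrix_vector_mult_diff_distrib add_eq_0_iff)
  have der: "((\<lambda>t. x t - x0) has_vector_derivative d) (at t) \<longleftrightarrow> (x has_vector_derivative d) (at t)"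
    for d t
    using has_vector_derivative_diff_const[of x x0 d "at t"] by simp
  show ?thesis
    unfolding trajectory_def eq by (simp add: der matrix_vector_mult_diff_distrib)
qed

lemma smib_equilibrium:
  assumes "B > 0"
  shows "state_mat (smib M D B P) *v vector [P / B, 0] + drift (smib M D B P) = 0"
  using assms by (simp add: smib_def matrix_vector_mult_def sum_2 vec_eq_iff forall_2)

end

theory Submission
  imports Defs "HOL-Real_Asymp.Real_Asymp"
begin

text \<open>The transfer function is sqrt B / (M s^2 + D s + B), so at s = i x the Gram matrix is
  the 1x1 matrix B / q(x), where q is \<open>smib_denom\<close>, and both norms become questions
  about q. For the 2-norm, the integral of B / q over the line is pi / D
  (\<open>has_bochner_integral_inverse_smib_denom\<close>): an inversion of the half-line shows that
  B / q is half of a function with an arctan primitive. For the infinity norm, q has to be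
  minimized. It is a quadratic in u = x^2 with vertex at u = (2 M B - D^2) / (2 M^2). If the vertex
  is nonnegative, a real frequency attains it, which is resonance; otherwise q is smallest at x = 0,
  which gives the static gain.\<close>

lemma matrix_inv_eqI:
  fixes A :: "'a::semiring_1 ^ 'n ^ 'm" and X :: "'a ^ 'm ^ 'n"
  assumes "A ** X = mat 1" "X ** A = mat 1"
  shows "matrix_inv A = X"
proof -
  have "A ** matrix_inv A = mat 1 \<and> matrix_inv A ** A = mat 1"
    unfolding matrix_inv_def by (rule someI[of _ X]) (use assms in blast)
  then show ?thesis
    by (metis assms(2) matrix_mul_assoc matrix_mul_lid matrix_mul_rid)
qed

lemma transfer_function_smib:
  assumes "M > 0" "B \<ge> 0" and nz: "of_real M * s\<^sup>2 + of_real D * s + of_real B \<noteq> (0::complex)"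
  shows "transfer_function (smib M D B P) s =
    mat (of_real (sqrt B) / (of_real M * s\<^sup>2 + of_real D * s + of_real B))"
proof -
  define d where "d = of_real M * s\<^sup>2 + of_real D * s + of_real B"
  let ?m = "complex_of_real M"
  define A where "A = mat s - map_matrix complex_of_real (state_mat (smib M D B P))"
  \<comment> \<open>The adjugate of \<open>A\<close> divided by its determinant d / M.\<close>
  define X :: "complex ^ 2 ^ 2" where
    "X = vector [vector [(?m * s + of_real D) / d, ?m / d], vector [- of_real B / d, ?m * s / d]]"
  have d: "d \<noteq> 0" and m: "?m \<noteq> 0" using assms by (auto simp: d_def)
  have A: "A = vector [vector [s, -1], vector [of_real B / ?m, s + of_real D / ?m]]"
    by (simp add: A_def smib_def map_matrix_def vec_eq_iff forall_2 mat_def)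
  have "A ** X = mat 1" "X ** A = mat 1"
    using d m by (simp_all add: A X_def matrix_matrix_mult_def vec_eq_iff forall_2 sum_2 mat_def
        divide_simps, simp_all add: d_def algebra_simps power2_eq_square)
  then have inv: "matrix_inv A = X" by (rule matrix_inv_eqI)
  show ?thesis
    using m unfolding transfer_function_def A_def[symmetric] inv d_def[symmetric]
    by (simp add: X_def smib_def map_matrix_def matrix_matrix_mult_def vec_eq_iff sum_2 mat_def)
qed

text \<open>The squared modulus of M s^2 + D s + B at s = i x.\<close>

definition smib_denom :: "real \<Rightarrow> real \<Rightarrow> real \<Rightarrow> real \<Rightarrow> real" where
  "smib_denom M D B x = (B - M * x\<^sup>2)\<^sup>2 + D\<^sup>2 * x\<^sup>2"

text \<open>The two squares never vanish together, so there is no pole on the imaginary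
  axis.\<close>

lemma smib_denom_pos:
  assumes "D > 0" "B > 0"
  shows "smib_denom M D B x > 0"
  unfolding smib_denom_def using assms
  by (cases "x = 0") (auto intro: add_nonneg_pos)

lemma gram_at_smib:
  assumes "M > 0" "D > 0" "B > 0"
  shows "gram_at (transfer_function (smib M D B P)) \<omega> = (B / smib_denom M D B \<omega>) *\<^sub>R mat 1"
proof -
  define d where "d = of_real M * (\<i> * of_real \<omega>)\<^sup>2 + of_real D * (\<i> * of_real \<omega>) + complex_of_real B"
  have d: "d = Complex (B - M * \<omega>\<^sup>2) (D * \<omega>)"
    by (simp add: d_def complex_eq_iff power_mult_distrib flip: of_real_power)
  have "cnj d * d = of_real (smib_denom M D B \<omega>)"
    unfolding d smib_denom_def
    by (simp add: complex_eq_iff power2_eq_square algebra_simps)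
  moreover from this have "d \<noteq> 0" using smib_denom_pos[OF assms(2,3), of M \<omega>] by auto
  moreover have "complex_of_real (sqrt B) * complex_of_real (sqrt B) = of_real B"
    using assms by (simp flip: of_real_mult)
  ultimately show ?thesis
    using transfer_function_smib[of M B "\<i> * of_real \<omega>" D P] assms
    by (simp add: d_def[symmetric] gram_at_def conj_transpose_def map_matrix_def transpose_def
        matrix_matrix_mult_def vec_eq_iff mat_def scaleR_conv_of_real[where 'a = complex])
qed

lemma lambda_max_scaleR_mat_1: "lambda_max (r *\<^sub>R mat 1 :: complex ^ 'm ^ 'm) = r"
proof -
  have mv: "(r *\<^sub>R mat 1 :: complex ^ 'm ^ 'm) *v v = of_real r *s v" for v
    by (simp add: matrix_vector_mult_def mat_def vec_eq_iff scaleR_conv_of_real[where 'a = complex] if_distrib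
        if_distribR cong: if_cong)
  have "eigenvalue (r *\<^sub>R mat 1 :: complex ^ 'm ^ 'm) (of_real x) \<longleftrightarrow> x = r" for x
    unfolding eigenvalue_def mv
    \<comment> \<open>The all-ones vector witnesses the eigenvalue r; for any other eigenvalue, a
      nonzero eigenvector is cancelled.\<close>
    by (auto intro: exI[of _ 1] simp: vector_mul_rcancel)
  then show ?thesis by (simp add: lambda_max_def)
qed

text \<open>The inversion \<open>x \<mapsto> B / (M x)\<close> exchanges \<open>B dx / q\<close> and
  \<open>M x\<^sup>2 dx / q\<close>, where \<open>q\<close> is the denominator, and their sum has the primitive \<open>arctan ((M x\<^sup>2 - B) / (D x)) / D\<close> whatever the sign of the
  discriminant \<open>D\<^sup>2 - 4 M B\<close>.\<close>

lemma has_bochner_integral_inverse_smib_denom: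
  assumes M: "M > 0" and D: "D > 0" and B: "B > 0"
  shows "has_bochner_integral lborel (\<lambda>x. 1 / smib_denom M D B x) (pi / (B * D))"
proof -
  define q where "q = smib_denom M D B"
  let ?f = "\<lambda>x. B / q x" and ?h = "\<lambda>x. M * x\<^sup>2 / q x"
  let ?F = "\<lambda>x. arctan ((M * x\<^sup>2 - B) / (D * x)) / D"
  have q: "q x > 0" for x unfolding q_def using D B by (rule smib_denom_pos)
  have cont: "continuous_on UNIV q" unfolding q_def smib_denom_def by (intro continuous_intros)
  have [measurable]: "q \<in> borel_measurable borel"
    using cont by (rule borel_measurable_continuous_onI)
  have deriv: "(?F has_real_derivative ?f x + ?h x) (at x)" if "x > 0" for x
  proof -
    \<comment> \<open>The numerator of the left side over the common denominator is q itself, so the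
      arctan derivative has q below.\<close>
    have "1 + ((M * x\<^sup>2 - B) / (D * x))\<^sup>2 = q x / (D * x)\<^sup>2"
      using that D by (simp add: q_def smib_denom_def field_simps power2_eq_square)
    moreover have "((\<lambda>x. (M * x\<^sup>2 - B) / (D * x)) has_real_derivative (M * x\<^sup>2 + B) / (D * x\<^sup>2)) (at x)"
      using that D by (auto intro!: derivative_eq_intros simp: field_simps power2_eq_square)
    ultimately show ?thesis
      using that D q[of x]
      by (auto intro!: derivative_eq_intros simp: field_simps power2_eq_square)
  qed
  \<comment> \<open>The primitive jumps at 0, so the integration is confined to the positive
    half-line, where it rises by pi / D.\<close>
  have lim0: "(?F \<longlongrightarrow> - (pi / 2) / D) (at_right 0)"
  proof -
    have "filterlim (\<lambda>x. (M * x\<^sup>2 - B) / (D * x)) at_bot (at_right 0)"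
      using M D B by real_asymp
    then have "((\<lambda>x. arctan ((M * x\<^sup>2 - B) / (D * x))) \<longlongrightarrow> - (pi / 2)) (at_right 0)"
      by (rule filterlim_compose[OF tendsto_arctan_at_bot])
    then show ?thesis using D by (intro tendsto_divide) auto
  qed
  have limi: "(?F \<longlongrightarrow> (pi / 2) / D) at_top"
  proof -
    have "filterlim (\<lambda>x. (M * x\<^sup>2 - B) / (D * x)) at_top at_top"
      using M D B by real_asymp
    then have "((\<lambda>x. arctan ((M * x\<^sup>2 - B) / (D * x))) \<longlongrightarrow> pi / 2) at_top"
      by (rule filterlim_compose[OF tendsto_arctan_at_top])
    then show ?thesis using D by (intro tendsto_divide) auto
  qed
  have sum_cont: "isCont (\<lambda>x. ?f x + ?h x) x" for x
    using q[of x] cont by (auto intro!: continuous_intros simp: continuous_on_eq_continuous_at)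
  have sum_nonneg: "0 \<le> ?f x + ?h x" for x
    using q[of x] M B by simp
  have ei: "einterval 0 \<infinity> = {0::real<..}" by (auto simp: einterval_def)
  have ftc: "set_integrable lborel {0<..} (\<lambda>x. ?f x + ?h x)"
    "(LBINT x=0..\<infinity>. ?f x + ?h x) = (pi / 2) / D - (- (pi / 2) / D)"
    unfolding ei[symmetric]
    by (rule interval_integral_FTC_nonneg[where F = ?F and a = 0 and b = \<infinity>];
        use deriv sum_cont sum_nonneg lim0 limi in \<open>simp add: ereal_tendsto_simps zero_ereal_def\<close>)+
  have int_sum: "(LINT x:{0<..}|lborel. ?f x + ?h x) = pi / D"
    using ftc(2) by (simp add: interval_lebesgue_integral_def ei)
  \<comment> \<open>Both summands are nonnegative, hence dominated by their integrable sum.\<close>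
  have int_f: "set_integrable lborel {0<..} ?f" and int_h: "set_integrable lborel {0<..} ?h"
    using q M B
    by (auto intro!: set_integrable_bound[OF ftc(1)] AE_I2 divide_right_mono
        simp: set_borel_measurable_def less_imp_le add_divide_distrib[symmetric] abs_of_nonneg)
  \<comment> \<open>The first factor is the absolute derivative of the inversion.\<close>
  have inversion: "\<bar>- (B / M) / x\<^sup>2\<bar> * ?f (B / M / x) = ?h x" if "x > 0" for x
  proof -
    have q_inv: "q (B / M / x) = (B / (M * x\<^sup>2))\<^sup>2 * q x"
      using that M by (simp add: q_def smib_denom_def field_simps power2_eq_square)
    show ?thesis
      unfolding q_inv using that M B q[of x] by (simp add: field_simps power2_eq_square)
  qed
  have img: "(\<lambda>x. B / M / x) ` {0<..} = {0<..}"
  proof (intro equalityI subsetI)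
    fix y :: real assume "y \<in> {0<..}"
    then show "y \<in> (\<lambda>x. B / M / x) ` {0<..}"
      using M B by (intro image_eqI[of _ _ "B / M / y"]) auto
  qed (use M B in auto)
  \<comment> \<open>Change of variables is an equivalence here; since the inversion maps the
    half-line onto itself, its right side reduces to integrability of B / q.\<close>
  have "(\<lambda>x. \<bar>- (B / M) / x\<^sup>2\<bar> * ?f (B / M / x)) absolutely_integrable_on {0<..} \<and>
      integral {0<..} (\<lambda>x. \<bar>- (B / M) / x\<^sup>2\<bar> * ?f (B / M / x)) = integral {0<..} ?f \<longleftrightarrow>
      ?f absolutely_integrable_on (\<lambda>x. B / M / x) ` {0<..} \<and>
      integral ((\<lambda>x. B / M / x) ` {0<..}) ?f = integral {0<..} ?f"
    by (rule has_absolute_integral_change_of_variables_1')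
      (use M B in \<open>auto intro!: derivative_eq_intros inj_onI simp: power2_eq_square\<close>)
  moreover have "?f absolutely_integrable_on {0<..}"
    using int_f unfolding set_integrable_def by (simp add: integrable_completion)
  ultimately have "integral {0<..} (\<lambda>x. \<bar>- (B / M) / x\<^sup>2\<bar> * ?f (B / M / x)) = integral {0<..} ?f"
    unfolding img by blast
  moreover have "integral {0<..} (\<lambda>x. \<bar>- (B / M) / x\<^sup>2\<bar> * ?f (B / M / x)) = integral {0<..} ?h"
    by (rule Henstock_Kurzweil_Integration.integral_cong) (rule inversion, simp)
  ultimately have "(LINT x:{0<..}|lborel. ?h x) = (LINT x:{0<..}|lborel. ?f x)"
    by (simp add: set_borel_integral_eq_integral int_f int_h)
  then have val: "(LINT x:{0<..}|lborel. ?f x) = pi / (2 * D)"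
    using int_sum by (simp add: set_integral_add int_f int_h)
  have "has_bochner_integral lborel (\<lambda>x. indicator {0<..} x *\<^sub>R ?f x) (pi / (2 * D))"
    using int_f val by (simp add: has_bochner_integral_iff set_integrable_def set_lebesgue_integral_def)
  \<comment> \<open>The rule for even functions expects the closed half-line; the point 0 is
    null.\<close>
  then have "has_bochner_integral lborel (\<lambda>x. indicator {0..} x *\<^sub>R ?f x) (pi / (2 * D))"
    by (rule has_bochner_integral_discrete_difference[where X="{0}", THEN iffD1, rotated 4])
      (auto split: split_indicator)
  then have "has_bochner_integral lborel ?f (2 *\<^sub>R (pi / (2 * D)))"
    by (rule has_bochner_integral_even_function) (simp add: q_def smib_denom_def)
  then have "has_bochner_integral lborel (\<lambda>x. (1 / B) * ?f x) ((1 / B) * (2 *\<^sub>R (pi / (2 * D))))"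
    by (rule has_bochner_integral_mult_right)
  then show ?thesis using B by (simp add: q_def)
qed

text \<open>Completing the square in x^2 leaves this constant.\<close>

lemma smib_denom_ge_resonance:
  assumes "M > 0"
  shows "smib_denom M D B x \<ge> D\<^sup>2 * (4 * M * B - D\<^sup>2) / (4 * M\<^sup>2)"
proof -
  have "smib_denom M D B x =
      D\<^sup>2 * (4 * M * B - D\<^sup>2) / (4 * M\<^sup>2) + (M * x\<^sup>2 - (2 * M * B - D\<^sup>2) / (2 * M))\<^sup>2"
    using assms by (simp add: smib_denom_def field_simps power2_eq_square)
  then show ?thesis by simp
qed

text \<open>At this frequency the completed square vanishes; the hypothesis on D makes the root
  real.\<close>

lemma smib_denom_resonance:
  assumes "M > 0" "D\<^sup>2 \<le> 2 * M * B"
  shows "smib_denom M D B (sqrt ((2 * M * B - D\<^sup>2) / (2 * M\<^sup>2))) =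
    D\<^sup>2 * (4 * M * B - D\<^sup>2) / (4 * M\<^sup>2)"
  using assms by (simp add: smib_denom_def field_simps power2_eq_square)

text \<open>With this much damping the coefficient of x^2 is nonnegative, so no term falls below the
  constant one.\<close>

lemma smib_denom_ge_static:
  assumes "2 * M * B \<le> D\<^sup>2"
  shows "smib_denom M D B x \<ge> B\<^sup>2"
proof -
  have "smib_denom M D B x = B\<^sup>2 + (D\<^sup>2 - 2 * M * B) * x\<^sup>2 + (M * x\<^sup>2)\<^sup>2"
    by (simp add: smib_denom_def algebra_simps power2_eq_square)
  then show ?thesis using assms by simp
qed

theorem theorem1:
  fixes M D B P :: real
  assumes "M > 0" and "D > 0" and "B > 0"
  defines "G \<equiv> transfer_function (smib M D B P)"
  shows "h2_norm G = ereal (sqrt (1 / (2 * D))) \<and>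
    hinf_norm G = ereal (if D\<^sup>2 / (2 * M * B) \<le> 1
                         then 2 * M * sqrt B / (D * sqrt (4 * M * B - D\<^sup>2))
                         else 1 / sqrt B)"
proof
  note pos = assms(1-3)
  have gram: "gram_at G = (\<lambda>\<omega>. (B / smib_denom M D B \<omega>) *\<^sub>R mat 1)"
    unfolding G_def using gram_at_smib[OF pos] by blast
  have "has_bochner_integral lborel (\<lambda>x. B * (1 / smib_denom M D B x)) (B * (pi / (B * D)))"
    by (intro has_bochner_integral_mult_right has_bochner_integral_inverse_smib_denom pos)
  then have int: "has_bochner_integral lborel (\<lambda>x. B / smib_denom M D B x) (pi / D)"
    using pos by simp
  have "has_bochner_integral lborel (gram_at G) ((pi / D) *\<^sub>R mat 1)"
    unfolding gram by (rule has_bochner_integral_scaleR_left) (rule int)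
  then have "integrable lborel (gram_at G)"
    "(LINT \<omega>|lborel. gram_at G \<omega>) = (pi / D) *\<^sub>R mat 1"
    by (auto simp: has_bochner_integral_iff)
  then show "h2_norm G = ereal (sqrt (1 / (2 * D)))"
    by (simp add: h2_norm_def trace_def mat_def)
  have hinf: "hinf_norm G = (SUP \<omega>. ereal (sqrt (B / smib_denom M D B \<omega>)))"
    unfolding hinf_norm_def gram lambda_max_scaleR_mat_1 ..
  \<comment> \<open>The gain decreases in q, so an attained positive minimum of q yields the
    supremum.\<close>
  have attained: "hinf_norm G = ereal (sqrt (B / m))"
    if "m > 0" "smib_denom M D B x0 = m" "\<And>x. smib_denom M D B x \<ge> m" for m x0
    unfolding hinf
  proof (rule SUP_eqI)
    show "ereal (sqrt (B / smib_denom M D B x)) \<le> ereal (sqrt (B / m))" for x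
      using that pos by (auto intro!: divide_left_mono mult_pos_pos smib_denom_pos)
    show "ereal (sqrt (B / m)) \<le> y"
      if "\<And>x. x \<in> UNIV \<Longrightarrow> ereal (sqrt (B / smib_denom M D B x)) \<le> y" for y
      using that[of x0] \<open>smib_denom M D B x0 = m\<close> by simp
  qed
  show "hinf_norm G = ereal (if D\<^sup>2 / (2 * M * B) \<le> 1
                         then 2 * M * sqrt B / (D * sqrt (4 * M * B - D\<^sup>2))
                         else 1 / sqrt B)"
  proof (cases "D\<^sup>2 / (2 * M * B) \<le> 1")
    case True
    then have le: "D\<^sup>2 \<le> 2 * M * B" using pos by simp
    moreover have "2 * M * B < 4 * M * B" using pos by simp
    ultimately have disc: "4 * M * B - D\<^sup>2 > 0" by linarith
    have "hinf_norm G = ereal (sqrt (B / (D\<^sup>2 * (4 * M * B - D\<^sup>2) / (4 * M\<^sup>2))))"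
      using disc pos
      by (intro attained[OF _ smib_denom_resonance[OF pos(1) le] smib_denom_ge_resonance[OF pos(1)]])
        auto
    also have "sqrt (B / (D\<^sup>2 * (4 * M * B - D\<^sup>2) / (4 * M\<^sup>2))) =
        2 * M * sqrt B / (D * sqrt (4 * M * B - D\<^sup>2))"
      using pos by (simp add: real_sqrt_divide real_sqrt_mult)
    finally show ?thesis using True by simp
  next
    case False
    then have "2 * M * B \<le> D\<^sup>2" using pos by simp
    then have "hinf_norm G = ereal (sqrt (B / B\<^sup>2))"
      \<comment> \<open>The bound B^2 is attained at frequency zero.\<close>
      using pos by (intro attained[of _ 0] smib_denom_ge_static) (auto simp: smib_denom_def)
    then show ?thesis using False pos by (simp add: power2_eq_square real_sqrt_divide)
  qed
qed

end
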